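(* (1) $\binom{\Omega}{\mathrm{T}}\subseteq\mathsf{S}_{fin}(\Gamma,\mathrm{T})$. (2) $\binom{\mathcal{B}_\Omega}{\mathcal{B}_\mathrm{T}}\subseteq\mathsf{S}_{fin}(\mathcal{B}_\Gamma,\mathcal{B}_\mathrm{T})$. (Inclusions of classes of sets of reals.)
   Context: All spaces $X$ are infinite sets of reals, and all covers considered are assumed not to contain $X$ as a member. A cover is an $\omega$-cover of $X$ if every finite subset of $X$ is contained in some member; a $\gamma$-cover if it is infinite and each point of $X$ lies in all but finitely many members; large if each point lies in infinitely many members. A large cover $\mathcal{U}$ of $X$ is a $\tau$-cover if for all $x,y\in X$, either ($x\in U\Rightarrow y\in U$) for all but finitely many $U\in\mathcal{U}$, or ($y\in U\Rightarrow x\in U$) for all but finitely many $U\in\mathcal{U}$. $\Omega,\Gamma,\mathrm{T}$ denote the collections of countable open $\omega$-, $\gamma$-, $\tau$-covers of $X$, and $\mathcal{B}_\Omega,\mathcal{B}_\Gamma,\mathcal{B}_\mathrm{T}$ the collections of countable Borel $\omega$-, $\gamma$-, $\tau$-covers. For collections $\mathfrak{U},\mathfrak{V}$ of covers: $X$ satisfies $\mathsf{S}_{fin}(\mathfrak{U},\mathfrak{V})$ if for every sequence $(\mathcal{U}_n)$ of members of $\mathfrak{U}$ there are finite (possibly empty) $\mathcal{F}_n\subseteq\mathcal{U}_n$ with $\bigcup_n\mathcal{F}_n\in\mathfrak{V}$; $X$ satisfies $\binom{\mathfrak{U}}{\mathfrak{V}}$ if every $\mathcal{U}\in\mathfrak{U}$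 has a subcollection $\mathcal{V}\subseteq\mathcal{U}$ with $\mathcal{V}\in\mathfrak{V}$. Properties are identified with the classes of sets satisfying them. *)

theory Defs
  imports "HOL-Analysis.Analysis"
begin

text \<open>
  Covers of \<open>X\<close> consist of subsets of \<open>X\<close>: "open" and "Borel" are meant relative to the subspace
  \<open>X\<close>. In particular \<open>X \<notin> \<U>\<close> says that no single member covers \<open>X\<close>.
\<close>

definition cover :: "real set \<Rightarrow> real set set \<Rightarrow> bool" where
  "cover X \<U> \<longleftrightarrow> \<Union>\<U> = X \<and> X \<notin> \<U>"

definition omega_cover :: "real set \<Rightarrow> real set set \<Rightarrow> bool" where
  "omega_cover X \<U> \<longleftrightarrow> cover X \<U> \<and> (\<forall>F. finite F \<and> F \<subseteq> X \<longrightarrow> (\<exists>U\<in>\<U>. F \<subseteq> U))"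

definition gamma_cover :: "real set \<Rightarrow> real set set \<Rightarrow> bool" where
  "gamma_cover X \<U> \<longleftrightarrow> cover X \<U> \<and> infinite \<U> \<and> (\<forall>x\<in>X. finite {U \<in> \<U>. x \<notin> U})"

definition large_cover :: "real set \<Rightarrow> real set set \<Rightarrow> bool" where
  "large_cover X \<U> \<longleftrightarrow> cover X \<U> \<and> (\<forall>x\<in>X. infinite {U \<in> \<U>. x \<in> U})"

definition tau_cover :: "real set \<Rightarrow> real set set \<Rightarrow> bool" where
  "tau_cover X \<U> \<longleftrightarrow> large_cover X \<U> \<and>
     (\<forall>x\<in>X. \<forall>y\<in>X. finite {U \<in> \<U>. \<not> (x \<in> U \<longrightarrow> y \<in> U)} \<or>
                   finite {U \<in> \<U>. \<not> (y \<in> U \<longrightarrow> x \<in> U)})"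

definition open_family :: "real set \<Rightarrow> real set set \<Rightarrow> bool" where
  "open_family X \<U> \<longleftrightarrow> countable \<U> \<and> (\<forall>U\<in>\<U>. openin (top_of_set X) U)"

definition borel_family :: "real set \<Rightarrow> real set set \<Rightarrow> bool" where
  "borel_family X \<U> \<longleftrightarrow> countable \<U> \<and> (\<forall>U\<in>\<U>. U \<in> sets (restrict_space borel X))"

type_synonym cover_class = "real set \<Rightarrow> real set set set"

definition Open_Omega :: cover_class where
  "Open_Omega X = {\<U>. open_family X \<U> \<and> omega_cover X \<U>}"

definition Open_Gamma :: cover_class where
  "Open_Gamma X = {\<U>. open_family X \<U> \<and> gamma_cover X \<U>}"

definition Open_Tau :: cover_class where
  "Open_Tau X = {\<U>. open_family X \<U> \<and> tau_cover X \<U>}"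

definition Borel_Omega :: cover_class where
  "Borel_Omega X = {\<U>. borel_family X \<U> \<and> omega_cover X \<U>}"

definition Borel_Gamma :: cover_class where
  "Borel_Gamma X = {\<U>. borel_family X \<U> \<and> gamma_cover X \<U>}"

definition Borel_Tau :: cover_class where
  "Borel_Tau X = {\<U>. borel_family X \<U> \<and> tau_cover X \<U>}"

text \<open>
  A property is identified with the class of the spaces, i.e. infinite sets of reals, that have it.
\<close>

definition S_fin :: "cover_class \<Rightarrow> cover_class \<Rightarrow> real set set" where
  "S_fin \<UU> \<VV> = {X. infinite X \<and>
     (\<forall>\<U> :: nat \<Rightarrow> real set set. (\<forall>n. \<U> n \<in> \<UU> X) \<longrightarrow>
        (\<exists>\<F>. (\<forall>n. finite (\<F> n) \<and> \<F> n \<subseteq> \<U> n) \<and> (\<Union>n. \<F> n) \<in> \<VV> X))}"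

definition Binom :: "cover_class \<Rightarrow> cover_class \<Rightarrow> real set set" where
  "Binom \<UU> \<VV> = {X. infinite X \<and> (\<forall>\<U>\<in>\<UU> X. \<exists>\<V>\<subseteq>\<U>. \<V> \<in> \<VV> X)}"

end

theory Submission
  imports Defs
begin

text \<open>
  Pick distinct points \<open>p n\<close> of \<open>X\<close> and thin out the given \<open>\<gamma>\<close>-covers \<open>\<U> n\<close> so that they are
  pairwise disjoint as families. The sets \<open>U - {p n}\<close> with \<open>U \<in> \<U> n\<close> form an \<open>\<omega>\<close>-cover, hence contain a
  \<open>\<tau>\<close>-cover \<open>\<V>\<close>. If infinitely many members of \<open>\<V>\<close> come from the same \<open>\<U> n\<close>, then \<open>p n\<close> is strictly
  below every other point in the preorder induced by \<open>\<V>\<close>. So this happens for at most one \<open>n\<close>,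
  and since \<open>p n\<close> is minimal and lies in none of these members, removing them leaves a \<open>\<tau>\<close>-cover.
  Now only finitely many members come from each \<open>\<U> n\<close>, and putting the points \<open>p n\<close> back changes the
  trace of the cover on any given point only finitely often.
\<close>

section \<open>Infinite subfamilies and \<gamma>-covers\<close>

lemma infinite_disjoint_subfamilies:
  fixes A :: "nat \<Rightarrow> 'a set"
  assumes "\<And>n. infinite (A n)"
  obtains B where "\<And>n. B n \<subseteq> A n" "\<And>n. infinite (B n)" "\<And>m n. m \<noteq> n \<Longrightarrow> B m \<inter> B n = {}"
proof -
  \<comment> \<open>Via \<open>prod_decode\<close> every index of \<open>A\<close> comes up
    infinitely often, so one sequence without repetitions serves all families: its values at the
    codes of \<open>(n, k)\<close> form \<open>B n\<close>, and injectivity makes these sets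
    infinite and disjoint.\<close>
  have "\<exists>f :: nat \<Rightarrow> 'a. \<forall>k. f k \<in> A (fst (prod_decode k)) - f ` {..<k}"
  proof (rule dependent_wellorder_choice)
    fix k :: nat and f g :: "nat \<Rightarrow> 'a" and r :: 'a
    assume "\<And>j. j < k \<Longrightarrow> f j = g j"
    then have "f ` {..<k} = g ` {..<k}"
      by (intro image_cong) auto
    then show "(r \<in> A (fst (prod_decode k)) - f ` {..<k}) = (r \<in> A (fst (prod_decode k)) - g ` {..<k})"
      by simp
  next
    fix k :: nat and f :: "nat \<Rightarrow> 'a"
    have "infinite (A (fst (prod_decode k)) - f ` {..<k})"
      using assms by (intro Diff_infinite_finite) auto
    then show "\<exists>r. r \<in> A (fst (prod_decode k)) - f ` {..<k}"
      using infinite_imp_nonempty by blast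
  qed
  then obtain f where f: "\<And>k. f k \<in> A (fst (prod_decode k)) - f ` {..<k}"
    by blast
  have "f i \<noteq> f j" if "i < j" for i j
    using f[of j] that by (metis DiffD2 imageI lessThan_iff)
  then have "inj f"
    by (metis injI linorder_neqE_nat)
  define B where "B n = (\<lambda>k. f (prod_encode (n, k))) ` UNIV" for n
  show thesis
  proof
    fix n
    show "B n \<subseteq> A n"
      unfolding B_def using f by (metis DiffD1 fst_conv image_subsetI prod_encode_inverse)
    have "inj (\<lambda>k. f (prod_encode (n, k)))"
      using \<open>inj f\<close> by (intro injI) (simp add: inj_eq prod_encode_eq)
    then show "infinite (B n)"
      unfolding B_def by (rule range_inj_infinite)
  next
    fix m n :: nat
    assume "m \<noteq> n"
    then show "B m \<inter> B n = {}"
      unfolding B_def using \<open>inj f\<close> by (auto simp: inj_eq prod_encode_eq)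
  qed
qed

text \<open>Discarding members only shrinks the finite set of members missing a point, so an
  infinite subfamily still has a member around each point.\<close>

lemma gamma_cover_subfamily:
  assumes "gamma_cover X \<U>" and "\<V> \<subseteq> \<U>" and "infinite \<V>"
  shows "gamma_cover X \<V>"
proof -
  have fin: "finite {V \<in> \<V>. x \<notin> V}" if "x \<in> X" for x
    by (rule finite_subset[of _ "{U \<in> \<U>. x \<notin> U}"]) (use assms that in \<open>auto simp: gamma_cover_def\<close>)
  have "\<exists>V\<in>\<V>. x \<in> V" if "x \<in> X" for x
  proof (rule ccontr)
    assume "\<not> (\<exists>V\<in>\<V>. x \<in> V)"
    then have "{V \<in> \<V>. x \<notin> V} = \<V>"
      by auto
    with fin[OF that] assms(3) show False
      by simp
  qed
  moreover have "\<Union>\<V> \<subseteq> X" "X \<notin> \<V>"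
    using assms by (auto simp: gamma_cover_def cover_def)
  ultimately show ?thesis
    using fin assms(3) by (auto simp: gamma_cover_def cover_def)
qed

text \<open>Each point of \<open>F\<close> is missed by finitely many members, so all but finitely
  many members contain \<open>F\<close>.\<close>

lemma gamma_cover_contains_finite:
  assumes "gamma_cover X \<U>" and "finite F" and "F \<subseteq> X"
  obtains U where "U \<in> \<U>" and "F \<subseteq> U"
proof -
  have "finite (\<Union>x\<in>F. {U \<in> \<U>. x \<notin> U})"
    using assms by (auto simp: gamma_cover_def)
  then have "infinite (\<U> - (\<Union>x\<in>F. {U \<in> \<U>. x \<notin> U}))"
    using assms(1) by (auto simp: gamma_cover_def)
  then obtain U where "U \<in> \<U> - (\<Union>x\<in>F. {U \<in> \<U>. x \<notin> U})"
    using infinite_imp_nonempty by blast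
  with that show thesis
    by blast
qed

text \<open>A finite \<open>F\<close> misses some \<open>p n\<close>, and a member of
  \<open>\<U> n\<close> containing \<open>F\<close> still contains it once \<open>p n\<close> is
  removed. No punctured set equals \<open>X\<close>, since \<open>p n\<close> lies in
  \<open>X\<close>.\<close>

lemma omega_cover_of_punctured_gamma_covers:
  fixes \<U> :: "nat \<Rightarrow> real set set"
  assumes \<gamma>: "\<And>n. gamma_cover X (\<U> n)" and "inj p" and "range p \<subseteq> X"
  shows "omega_cover X (\<Union>n. (\<lambda>U. U - {p n}) ` \<U> n)"
proof -
  let ?\<W> = "\<Union>n. (\<lambda>U. U - {p n}) ` \<U> n"
  have contains: "\<exists>W\<in>?\<W>. F \<subseteq> W" if F: "finite F" "F \<subseteq> X" for F
  proof -
    have "infinite (range p)"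
      using \<open>inj p\<close> by (rule range_inj_infinite)
    then have "infinite (range p - F)"
      using \<open>finite F\<close> by simp
    then obtain n where "p n \<notin> F"
      using infinite_imp_nonempty by blast
    moreover obtain U where "U \<in> \<U> n" "F \<subseteq> U"
      using gamma_cover_contains_finite[OF \<gamma> F] .
    ultimately show ?thesis
      by (intro bexI[of _ "U - {p n}"]) auto
  qed
  have "\<exists>W\<in>?\<W>. x \<in> W" if "x \<in> X" for x
    using contains[of "{x}"] that by simp
  then have "X \<subseteq> \<Union>?\<W>"
    by (meson UnionI subsetI)
  moreover have "U \<subseteq> X" if "U \<in> \<U> n" for U n
    using \<gamma>[of n] that by (auto simp: gamma_cover_def cover_def)
  then have "\<Union>?\<W> \<subseteq> X"
    by blast
  ultimately have "\<Union>?\<W> = X"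
    by (rule subset_antisym[rotated])
  moreover have "X \<notin> ?\<W>"
    using assms(3) by auto
  ultimately show ?thesis
    using contains unfolding omega_cover_def cover_def by simp
qed

section \<open>Modifications that preserve \<tau>-covers\<close>

lemma tau_cover_remove_avoiding_minimal:
  assumes \<tau>: "tau_cover X \<V>" and "p \<in> X"
    and minimal: "\<And>y. y \<in> X \<Longrightarrow> finite {V \<in> \<V>. \<not> (p \<in> V \<longrightarrow> y \<in> V)}"
    and avoid: "\<And>V. V \<in> \<P> \<Longrightarrow> p \<notin> V"
  shows "tau_cover X (\<V> - \<P>)"
proof -
  have large: "infinite {V \<in> \<V> - \<P>. y \<in> V}" if "y \<in> X" for y
  proof
    assume fin: "finite {V \<in> \<V> - \<P>. y \<in> V}"
    \<comment> \<open>Members containing \<open>p\<close> survive the removal of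
      \<open>\<P>\<close>, and almost all of them contain \<open>y\<close>. So \<open>y\<close>
      inherits largeness from \<open>p\<close>.\<close>
    have "{V \<in> \<V>. p \<in> V} \<subseteq> {V \<in> \<V> - \<P>. y \<in> V} \<union> {V \<in> \<V>. \<not> (p \<in> V \<longrightarrow> y \<in> V)}"
      using avoid by auto
    then have "finite {V \<in> \<V>. p \<in> V}"
      by (rule finite_subset) (use fin minimal[OF that] in simp)
    with \<tau> \<open>p \<in> X\<close> show False
      by (auto simp: tau_cover_def large_cover_def)
  qed
  have "\<exists>V\<in>\<V> - \<P>. y \<in> V" if "y \<in> X" for y
  proof -
    have "{V \<in> \<V> - \<P>. y \<in> V} \<noteq> {}"
      using large[OF that] infinite_imp_nonempty by blast
    then show ?thesis
      by blast
  qed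
  then have "cover X (\<V> - \<P>)"
    using \<tau> by (fastforce simp: tau_cover_def large_cover_def cover_def)
  moreover have "finite {V \<in> \<V> - \<P>. \<not> (x \<in> V \<longrightarrow> y \<in> V)}"
    if "finite {V \<in> \<V>. \<not> (x \<in> V \<longrightarrow> y \<in> V)}" for x y
    by (rule finite_subset[OF _ that]) auto
  ultimately show ?thesis
    using \<tau> large unfolding tau_cover_def large_cover_def by blast
qed

text \<open>For a fixed point \<open>x\<close>, the sets \<open>W\<close> and \<open>u W\<close> can
  disagree about \<open>x\<close> only when \<open>x = p (n W)\<close>. As \<open>p\<close> is
  injective this fixes \<open>n W\<close>, so it happens in a single finite fibre. Injectivity of
  \<open>u\<close> keeps infinite sets of members infinite.\<close>

lemma tau_cover_restore_points:
  fixes n :: "real set \<Rightarrow> nat" and u :: "real set \<Rightarrow> real set" and p :: "nat \<Rightarrow> real"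
  assumes \<tau>: "tau_cover X \<W>" and "inj p" and inj: "inj_on u \<W>"
    and u: "\<And>W. W \<in> \<W> \<Longrightarrow> u W - {p (n W)} = W" "\<And>W. W \<in> \<W> \<Longrightarrow> u W \<subset> X"
    and fibre: "\<And>k. finite {W \<in> \<W>. n W = k}"
  shows "tau_cover X (u ` \<W>)"
proof -
  have sub: "W \<subseteq> u W" if "W \<in> \<W>" for W
    using u(1)[OF that] by blast
  have \<W>: "\<Union>\<W> = X" "\<And>x. x \<in> X \<Longrightarrow> infinite {W \<in> \<W>. x \<in> W}"
    using \<tau> by (auto simp: tau_cover_def large_cover_def cover_def)
  have "X \<subseteq> \<Union>(u ` \<W>)"
    using \<W>(1) sub by blast
  then have cov: "cover X (u ` \<W>)"
    using u(2) unfolding cover_def by blast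
  have large: "infinite {U \<in> u ` \<W>. x \<in> U}" if "x \<in> X" for x
  proof
    assume "finite {U \<in> u ` \<W>. x \<in> U}"
    moreover have "u ` {W \<in> \<W>. x \<in> W} \<subseteq> {U \<in> u ` \<W>. x \<in> U}"
      using sub by auto
    ultimately have "finite (u ` {W \<in> \<W>. x \<in> W})"
      by (rule rev_finite_subset)
    then have "finite {W \<in> \<W>. x \<in> W}"
      by (rule finite_imageD) (rule inj_on_subset[OF inj], auto)
    with \<W>(2)[OF that] show False
      by simp
  qed
  have trans: "finite {U \<in> u ` \<W>. \<not> (x \<in> U \<longrightarrow> y \<in> U)}"
    if "finite {W \<in> \<W>. \<not> (x \<in> W \<longrightarrow> y \<in> W)}" for x y
  proof -
    have "finite {W \<in> \<W>. x = p (n W)}"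
    proof (cases "x \<in> range p")
      case True
      then obtain k where "x = p k"
        by blast
      then show ?thesis
        using fibre[of k] \<open>inj p\<close> by (simp add: inj_eq eq_commute)
    next
      case False
      then have "{W \<in> \<W>. x = p (n W)} = {}"
        by auto
      then show ?thesis
        by (metis finite.emptyI)
    qed
    \<comment> \<open>If \<open>u W\<close> contains \<open>x\<close> but not \<open>y\<close>, then
      \<open>W\<close> omits \<open>y\<close> too, and it contains \<open>x\<close> unless
      \<open>x\<close> is the removed point.\<close>
    moreover have "{U \<in> u ` \<W>. \<not> (x \<in> U \<longrightarrow> y \<in> U)} \<subseteq>
        u ` ({W \<in> \<W>. \<not> (x \<in> W \<longrightarrow> y \<in> W)} \<union> {W \<in> \<W>. x = p (n W)})"
      using u(1) by blast
    ultimately show ?thesis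
      using that by (meson finite_UnI finite_imageI finite_subset)
  qed
  show ?thesis
    using \<tau> cov large trans unfolding tau_cover_def large_cover_def by blast
qed

section \<open>The selection argument\<close>

text \<open>Assumption \<open>\<omega>\<close> speaks only of families of punctured members of the
  \<open>\<U> n\<close>, so that open and Borel covers are handled by one argument.\<close>

lemma gamma_covers_finite_selection:
  fixes \<U> :: "nat \<Rightarrow> real set set"
  assumes "infinite X" and \<gamma>: "\<And>n. gamma_cover X (\<U> n)"
    and countable: "\<And>n. countable (\<U> n)"
    and \<omega>: "\<And>\<W>. omega_cover X \<W> \<Longrightarrow> countable \<W> \<Longrightarrow> (\<forall>W\<in>\<W>. \<exists>n U x. U \<in> \<U> n \<and> W = U - {x}) \<Longrightarrow>
          \<exists>\<V>\<subseteq>\<W>. tau_cover X \<V>"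
  shows "\<exists>\<F>. (\<forall>n. finite (\<F> n) \<and> \<F> n \<subseteq> \<U> n) \<and> tau_cover X (\<Union>n. \<F> n)"
proof -
  obtain p :: "nat \<Rightarrow> real" where p: "inj p" "range p \<subseteq> X"
    using \<open>infinite X\<close> infinite_countable_subset by blast
  have "\<And>n. infinite (\<U> n)"
    using \<gamma> by (simp add: gamma_cover_def)
  then obtain B where B: "\<And>n. B n \<subseteq> \<U> n" "\<And>n. infinite (B n)" "\<And>m n. m \<noteq> n \<Longrightarrow> B m \<inter> B n = {}"
    using infinite_disjoint_subfamilies[of \<U>] by metis
  have \<gamma>B: "gamma_cover X (B n)" for n
    using gamma_cover_subfamily[OF \<gamma> B(1,2)] .
  let ?\<W> = "\<Union>n. (\<lambda>U. U - {p n}) ` B n"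
  have "\<forall>W\<in>?\<W>. \<exists>n U x. U \<in> \<U> n \<and> W = U - {x}"
    using B(1) by blast
  moreover have "countable ?\<W>"
    by (intro countable_UN countable_image countable_subset[OF B(1) countable]) simp
  ultimately have "\<exists>\<V>\<subseteq>?\<W>. tau_cover X \<V>"
    by (intro \<omega> omega_cover_of_punctured_gamma_covers[OF \<gamma>B p])
  then obtain \<V> where \<V>: "\<V> \<subseteq> ?\<W>" "tau_cover X \<V>"
    by blast
  have "\<forall>V\<in>\<V>. \<exists>k U. U \<in> B k \<and> U - {p k} = V"
    using \<V>(1) by blast
  then obtain n u where nu: "\<And>V. V \<in> \<V> \<Longrightarrow> u V \<in> B (n V)" "\<And>V. V \<in> \<V> \<Longrightarrow> u V - {p (n V)} = V"
    by metis
  \<comment> \<open>Since the \<open>B n\<close> are disjoint, \<open>u V\<close> determines the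
    index \<open>n V\<close>, and with it the removed point and \<open>V\<close>.\<close>
  have inj: "inj_on u \<V>"
  proof (rule inj_onI)
    fix V W
    assume VW: "V \<in> \<V>" "W \<in> \<V>" "u V = u W"
    then have "n V = n W"
      using B(3)[of "n V" "n W"] nu(1)[of V] nu(1)[of W] by auto
    then show "V = W"
      using VW nu(2) by metis
  qed
  \<comment> \<open>All sets in the fibre of \<open>k\<close> omit \<open>p k\<close>. Almost all
    contain \<open>y\<close>, because their originals lie in the \<gamma>-cover \<open>B k\<close>
    and \<open>y\<close> is not the removed point. An infinite fibre thus refutes one alternative of
    the \<tau>-condition and forces the other.\<close>
  have strictly_below: "finite {V \<in> \<V>. \<not> (p k \<in> V \<longrightarrow> y \<in> V)}" "infinite {V \<in> \<V>. \<not> (y \<in> V \<longrightarrow> p k \<in> V)}"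
    if inf: "infinite {V \<in> \<V>. n V = k}" and y: "y \<in> X" "y \<noteq> p k" for k y
  proof -
    have "u ` {V \<in> \<V>. n V = k \<and> y \<notin> V} \<subseteq> {U \<in> B k. y \<notin> U}"
    proof
      fix U
      assume "U \<in> u ` {V \<in> \<V>. n V = k \<and> y \<notin> V}"
      then obtain V where V: "U = u V" "V \<in> \<V>" "n V = k" "y \<notin> V"
        by blast
      then show "U \<in> {U \<in> B k. y \<notin> U}"
        using nu[of V] y(2) by auto
    qed
    moreover have "finite {U \<in> B k. y \<notin> U}"
      using \<gamma>B[of k] y(1) by (simp add: gamma_cover_def)
    ultimately have "finite (u ` {V \<in> \<V>. n V = k \<and> y \<notin> V})"
      by (rule finite_subset)
    then have "finite {V \<in> \<V>. n V = k \<and> y \<notin> V}"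
      by (rule finite_imageD) (rule inj_on_subset[OF inj], auto)
    with inf have "infinite ({V \<in> \<V>. n V = k} - {V \<in> \<V>. n V = k \<and> y \<notin> V})"
      by simp
    moreover have "{V \<in> \<V>. n V = k} - {V \<in> \<V>. n V = k \<and> y \<notin> V} \<subseteq> {V \<in> \<V>. \<not> (y \<in> V \<longrightarrow> p k \<in> V)}"
      using nu(2) by blast
    ultimately show "infinite {V \<in> \<V>. \<not> (y \<in> V \<longrightarrow> p k \<in> V)}"
      using infinite_super by blast
    then show "finite {V \<in> \<V>. \<not> (p k \<in> V \<longrightarrow> y \<in> V)}"
      using \<V>(2) y(1) p(2) unfolding tau_cover_def by blast
  qed
  have pX: "p k \<in> X" for k
    using p(2) by blast
  obtain \<W> where \<W>: "\<W> \<subseteq> \<V>" "tau_cover X \<W>" "\<And>k. finite {V \<in> \<W>. n V = k}"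
  proof (cases "\<exists>k. infinite {V \<in> \<V>. n V = k}")
    case False
    then show thesis
      using that[of \<V>] \<V>(2) by blast
  next
    case True
    then obtain k where k: "infinite {V \<in> \<V>. n V = k}"
      by blast
    \<comment> \<open>Two infinite fibres would put each of \<open>p j\<close> and
      \<open>p k\<close> strictly below the other.\<close>
    have others: "finite {V \<in> \<V>. n V = j}" if "j \<noteq> k" for j
    proof (rule ccontr)
      assume j: "infinite {V \<in> \<V>. n V = j}"
      have "p j \<noteq> p k"
        using p(1) that by (simp add: inj_eq)
      then show False
        using strictly_below(1)[OF j pX[of k]] strictly_below(2)[OF k pX[of j]] by auto
    qed
    show thesis
    proof
      show "\<V> - {V \<in> \<V>. n V = k} \<subseteq> \<V>"
        by blast
      show "tau_cover X (\<V> - {V \<in> \<V>. n V = k})"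
      proof (rule tau_cover_remove_avoiding_minimal[OF \<V>(2) pX[of k]])
        fix y assume "y \<in> X"
        then show "finite {V \<in> \<V>. \<not> (p k \<in> V \<longrightarrow> y \<in> V)}"
          using strictly_below(1)[OF k] by (cases "y = p k") auto
      next
        fix V assume "V \<in> {V \<in> \<V>. n V = k}"
        then show "p k \<notin> V"
          using nu(2) by blast
      qed
      show "finite {V \<in> \<V> - {V \<in> \<V>. n V = k}. n V = j}" for j
      proof (cases "j = k")
        case True
        then have "{V \<in> \<V> - {V \<in> \<V>. n V = k}. n V = j} = {}"
          by auto
        then show ?thesis
          by (metis finite.emptyI)
      next
        case False
        show ?thesis
          by (rule finite_subset[OF _ others[OF False]]) auto
      qed
    qed
  qed
  have "u V \<subset> X" if "V \<in> \<V>" for V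
    using nu(1)[OF that] \<gamma>B[of "n V"] by (auto simp: gamma_cover_def cover_def)
  then have "tau_cover X (u ` \<W>)"
    using nu(2) \<W>(1)
    by (intro tau_cover_restore_points[OF \<W>(2) p(1) inj_on_subset[OF inj \<W>(1)] _ _ \<W>(3)]) blast+
  \<comment> \<open>The fibres of \<open>n\<close> give the finite selections; at an index whose
    fibre was discarded the selection is empty.\<close>
  moreover have "u ` \<W> = (\<Union>k. u ` {V \<in> \<W>. n V = k})"
    by auto
  ultimately have "tau_cover X (\<Union>k. u ` {V \<in> \<W>. n V = k})"
    by simp
  moreover have "finite (u ` {V \<in> \<W>. n V = k})" for k
    using \<W>(3) by (rule finite_imageI)
  moreover have "u ` {V \<in> \<W>. n V = k} \<subseteq> \<U> k" for k
  proof (rule image_subsetI)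
    fix V
    assume "V \<in> {V \<in> \<W>. n V = k}"
    then have "u V \<in> B k"
      using nu(1)[of V] \<W>(1) by auto
    then show "u V \<in> \<U> k"
      using B(1) by blast
  qed
  ultimately show ?thesis
    by (intro exI[of _ "\<lambda>k. u ` {V \<in> \<W>. n V = k}"] conjI allI)
qed

section \<open>Open and Borel covers\<close>

text \<open>\<open>P X U\<close> stands for "\<open>U\<close> is open in \<open>X\<close>" or
  "\<open>U\<close> is Borel in \<open>X\<close>". Stability under deleting a point puts the
  punctured sets back into the class of allowed members.\<close>

lemma Binom_subset_S_fin:
  fixes P :: "real set \<Rightarrow> real set \<Rightarrow> bool"
  assumes remove: "\<And>X U x. P X U \<Longrightarrow> P X (U - {x})"
  defines "fam \<equiv> \<lambda>X \<U>. countable \<U> \<and> (\<forall>U\<in>\<U>. P X U)"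
  shows "Binom (\<lambda>X. {\<U>. fam X \<U> \<and> omega_cover X \<U>}) (\<lambda>X. {\<U>. fam X \<U> \<and> tau_cover X \<U>})
    \<subseteq> S_fin (\<lambda>X. {\<U>. fam X \<U> \<and> gamma_cover X \<U>}) (\<lambda>X. {\<U>. fam X \<U> \<and> tau_cover X \<U>})"
proof
  fix X
  assume X: "X \<in> Binom (\<lambda>X. {\<U>. fam X \<U> \<and> omega_cover X \<U>}) (\<lambda>X. {\<U>. fam X \<U> \<and> tau_cover X \<U>})"
  have "\<exists>\<F>. (\<forall>n. finite (\<F> n) \<and> \<F> n \<subseteq> \<U> n) \<and> fam X (\<Union>n. \<F> n) \<and> tau_cover X (\<Union>n. \<F> n)"
    if \<U>: "\<forall>n. fam X (\<U> n) \<and> gamma_cover X (\<U> n)" for \<U> :: "nat \<Rightarrow> real set set"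
  proof -
    have "\<exists>\<F>. (\<forall>n. finite (\<F> n) \<and> \<F> n \<subseteq> \<U> n) \<and> tau_cover X (\<Union>n. \<F> n)"
    proof (rule gamma_covers_finite_selection)
      show "infinite X"
        using X by (simp add: Binom_def)
      show "gamma_cover X (\<U> n)" "countable (\<U> n)" for n
        using \<U> by (auto simp: fam_def)
    next
      fix \<W>
      assume \<W>: "omega_cover X \<W>" "countable \<W>"
        and members: "\<forall>W\<in>\<W>. \<exists>n U x. U \<in> \<U> n \<and> W = U - {x}"
      have "P X W" if "W \<in> \<W>" for W
        using members that remove \<U> unfolding fam_def by metis
      with \<W> have "\<W> \<in> {\<U>. fam X \<U> \<and> omega_cover X \<U>}"
        by (simp add: fam_def)
      with X show "\<exists>\<V>\<subseteq>\<W>. tau_cover X \<V>"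
        unfolding Binom_def by blast
    qed
    then obtain \<F> where \<F>: "\<forall>n. finite (\<F> n) \<and> \<F> n \<subseteq> \<U> n" "tau_cover X (\<Union>n. \<F> n)"
      by blast
    then have "fam X (\<Union>n. \<F> n)"
      using \<U> unfolding fam_def by (auto intro: countable_finite)
    with \<F> show ?thesis
      by blast
  qed
  with X show "X \<in> S_fin (\<lambda>X. {\<U>. fam X \<U> \<and> gamma_cover X \<U>}) (\<lambda>X. {\<U>. fam X \<U> \<and> tau_cover X \<U>})"
    by (simp add: S_fin_def Binom_def)
qed

theorem theorem2p7:
  shows "Binom Open_Omega Open_Tau \<subseteq> S_fin Open_Gamma Open_Tau \<and>
         Binom Borel_Omega Borel_Tau \<subseteq> S_fin Borel_Gamma Borel_Tau"
proof
  have "openin (top_of_set X) (U - {x})" if "openin (top_of_set X) U" for X U and x :: real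
    using openin_delete[OF that] .
  from Binom_subset_S_fin[of "\<lambda>X U. openin (top_of_set X) U", OF this]
  show "Binom Open_Omega Open_Tau \<subseteq> S_fin Open_Gamma Open_Tau"
    by (simp add: Open_Omega_def[abs_def] Open_Tau_def[abs_def] Open_Gamma_def[abs_def] open_family_def)
next
  have "U - {x} \<in> sets (restrict_space borel X)" if U: "U \<in> sets (restrict_space borel X)"
    for X U and x :: real
  proof -
    obtain A where "A \<in> sets borel" "U = X \<inter> A"
      using U by (auto simp: sets_restrict_space)
    \<comment> \<open>Points are closed, so \<open>A - {x}\<close> is Borel; its trace on
      \<open>X\<close> is \<open>U - {x}\<close>.\<close>
    then show ?thesis
      unfolding sets_restrict_space by (intro image_eqI[of _ _ "A - {x}"]) auto
  qed
  from Binom_subset_S_fin[of "\<lambda>X U. U \<in> sets (restrict_space borel X)", OF this]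
  show "Binom Borel_Omega Borel_Tau \<subseteq> S_fin Borel_Gamma Borel_Tau"
    by (simp add: Borel_Omega_def[abs_def] Borel_Tau_def[abs_def] Borel_Gamma_def[abs_def] borel_family_def)
qed

end
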